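(* Let $(P,\rho)$ be a weakly ranked locally finite poset and $\kappa$ a $(P,\rho)$-kernel, with right and left KLS functions $f,g$, $Z$-function $Z$, and right and left augmented Chow functions $F,G$. Then: (i) if $f_{st}$ has non-negative coefficients for all $s\le t$, then so does $F_{st}$ for all $s\le t$; if $g_{st}$ has non-negative coefficients for all $s\le t$, then so does $G_{st}$ for all $s\le t$; (ii) if every $Z_{st}$ has non-negative coefficients and is unimodal and every $g_{st}$ has non-negative coefficients, then every $F_{st}$ is unimodal; if every $Z_{st}$ has non-negative coefficients and is unimodal and every $f_{st}$ has non-negative coefficients, then every $G_{st}$ is unimodal.
   Context: $P$ is a locally finite poset; $\operatorname{Int}(P)$ is its set of closed intervals. A weak rank function is a map $\rho:\operatorname{Int}(P)\to\mathbb{Z}_{\ge0}$, $[s,t]\mapsto\rho_{st}$, with $\rho_{st}>0$ whenever $s<t$ and $\rho_{st}=\rho_{sw}+\rho_{wt}$ for $s\le w\le t$. The incidence algebra $\mathcal{I}(P)$ consists of maps $a$ assigning to each $[s,t]$ a polynomial $a_{st}(x)\in\mathbb{Z}[x]$, with product $(ab)_{st}=\sum_{s\le w\le t}a_{sw}b_{wt}$. $\mathcal{I}_\rho(P)=\{a:\deg a_{st}\le\rho_{st}\}$, and $a^{\mathrm{rev}}_{st}(x)=x^{\rho_{st}}a_{st}(x^{-1})$. A $(P,\rho)$-kernel is $\kappa\in\mathcal{I}_\rho(P)$ with $\kappa_{ss}=1$ for all $s$ and $\kappa^{-1}=\kappa^{\mathrm{rev}}$. For $s<t$, $\kappa_{st}$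 is divisible by $x-1$; the reduced kernel has $\overline{\kappa}_{st}=\kappa_{st}/(x-1)$ for $s<t$ and $\overline{\kappa}_{ss}=-1$. The Chow function is $\mathrm{H}=-(\overline{\kappa})^{-1}$. The right KLS function is the unique $f\in\mathcal{I}_\rho(P)$ with $f_{ss}=1$, $\deg f_{st}<\rho_{st}/2$ for $s<t$, $f^{\mathrm{rev}}=\kappa f$; the left KLS function is the unique $g\in\mathcal{I}_\rho(P)$ with $g_{ss}=1$, $\deg g_{st}<\rho_{st}/2$ for $s<t$, $g^{\mathrm{rev}}=g\kappa$. $Z=g^{\mathrm{rev}}f$, $F=\mathrm{H}f^{\mathrm{rev}}$, $G=g^{\mathrm{rev}}\mathrm{H}$. A polynomial $a_0+\dots+a_mx^m$ with non-negative coefficients is unimodal if $a_0\le\dots\le a_j\ge a_{j+1}\ge\dots\ge a_m$ for some $j$. *)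

theory Defs
  imports "HOL-Computational_Algebra.Polynomial"
begin

text \<open>
  A locally finite poset is the universe of a type of class \<open>order\<close> all of whose intervals
  \<open>{s..t}\<close> are finite. A function on closed intervals \<open>[s,t]\<close> is written as a function of the two
  endpoints. Elements of the incidence algebra are normalised to vanish when \<open>\<not> s \<le> t\<close>, so that
  equality in the incidence algebra is equality of functions; the values of a weak rank function
  outside \<open>s \<le> t\<close> are never used.
\<close>

definition weak_rank_function :: "('a::order \<Rightarrow> 'a \<Rightarrow> nat) \<Rightarrow> bool" where
  "weak_rank_function \<rho> \<longleftrightarrow>
     (\<forall>s t. s < t \<longrightarrow> 0 < \<rho> s t) \<and>
     (\<forall>s w t. s \<le> w \<longrightarrow> w \<le> t \<longrightarrow> \<rho> s t = \<rho> s w + \<rho> w t)"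

type_synonym 'a interval_map = "'a \<Rightarrow> 'a \<Rightarrow> int poly"

definition incidence_algebra :: "('a::order) interval_map set" where
  "incidence_algebra = {a. \<forall>s t. \<not> s \<le> t \<longrightarrow> a s t = 0}"

definition inc_mult :: "('a::order) interval_map \<Rightarrow> 'a interval_map \<Rightarrow> 'a interval_map"
    (infixl \<open>\<star>\<close> 70) where
  "(a \<star> b) s t = (\<Sum>w\<in>{s..t}. a s w * b w t)"

definition inc_one :: "('a::order) interval_map" where
  "inc_one s t = (if s = t then 1 else 0)"

text \<open>The inverse is meaningful only for invertible \<open>a\<close>; this is the case over a locally finite
  poset as soon as every diagonal entry \<open>a s s\<close> is \<open>1\<close> or \<open>-1\<close>.\<close>

definition inc_inverse :: "('a::order) interval_map \<Rightarrow> 'a interval_map" where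
  "inc_inverse a =
     (THE b. b \<in> incidence_algebra \<and> a \<star> b = inc_one \<and> b \<star> a = inc_one)"

definition bounded_incidence_algebra ::
    "('a::order \<Rightarrow> 'a \<Rightarrow> nat) \<Rightarrow> 'a interval_map set" where
  "bounded_incidence_algebra \<rho> =
     {a \<in> incidence_algebra. \<forall>s t. s \<le> t \<longrightarrow> degree (a s t) \<le> \<rho> s t}"

text \<open>Since \<open>reflect_poly p\<close> is \<open>x^(degree p) * p(1/x)\<close>, the following is
  \<open>x^(\<rho> s t) * (a s t)(1/x)\<close> for \<open>a \<in> bounded_incidence_algebra \<rho>\<close>, compare the lemma
  \<open>coeff_inc_rev\<close> below.\<close>

definition inc_rev ::
    "('a::order \<Rightarrow> 'a \<Rightarrow> nat) \<Rightarrow> 'a interval_map \<Rightarrow> 'a interval_map" where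
  "inc_rev \<rho> a s t = monom 1 (\<rho> s t - degree (a s t)) * reflect_poly (a s t)"

lemma coeff_inc_rev:
  assumes "a \<in> bounded_incidence_algebra \<rho>" and "s \<le> t"
  shows "coeff (inc_rev \<rho> a s t) i = (if i \<le> \<rho> s t then coeff (a s t) (\<rho> s t - i) else 0)"
proof -
  have "degree (a s t) \<le> \<rho> s t"
    using assms by (auto simp: bounded_incidence_algebra_def)
  then show ?thesis
    by (auto simp: inc_rev_def coeff_monom_mult coeff_reflect_poly coeff_eq_0)
qed

definition poset_kernel :: "('a::order \<Rightarrow> 'a \<Rightarrow> nat) \<Rightarrow> 'a interval_map \<Rightarrow> bool" where
  "poset_kernel \<rho> \<kappa> \<longleftrightarrow>
     \<kappa> \<in> bounded_incidence_algebra \<rho> \<and> (\<forall>s. \<kappa> s s = 1) \<and> inc_inverse \<kappa> = inc_rev \<rho> \<kappa>"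

text \<open>For a kernel, \<open>\<kappa> s t\<close> is divisible by \<open>x - 1\<close> whenever \<open>s < t\<close>, so \<open>div\<close> is exact division
  in the integer polynomials.\<close>

definition reduced_kernel :: "('a::order) interval_map \<Rightarrow> 'a interval_map" where
  "reduced_kernel \<kappa> s t =
     (if s = t then -1 else if s < t then \<kappa> s t div [:-1, 1:] else 0)"

definition Chow_function :: "('a::order) interval_map \<Rightarrow> 'a interval_map" where
  "Chow_function \<kappa> s t = - inc_inverse (reduced_kernel \<kappa>) s t"

definition right_KLS_function ::
    "('a::order \<Rightarrow> 'a \<Rightarrow> nat) \<Rightarrow> 'a interval_map \<Rightarrow> 'a interval_map \<Rightarrow> bool" where
  "right_KLS_function \<rho> \<kappa> f \<longleftrightarrow>
     f \<in> bounded_incidence_algebra \<rho> \<and> (\<forall>s. f s s = 1) \<and>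
     (\<forall>s t. s < t \<longrightarrow> 2 * degree (f s t) < \<rho> s t) \<and>
     inc_rev \<rho> f = \<kappa> \<star> f"

definition left_KLS_function ::
    "('a::order \<Rightarrow> 'a \<Rightarrow> nat) \<Rightarrow> 'a interval_map \<Rightarrow> 'a interval_map \<Rightarrow> bool" where
  "left_KLS_function \<rho> \<kappa> g \<longleftrightarrow>
     g \<in> bounded_incidence_algebra \<rho> \<and> (\<forall>s. g s s = 1) \<and>
     (\<forall>s t. s < t \<longrightarrow> 2 * degree (g s t) < \<rho> s t) \<and>
     inc_rev \<rho> g = g \<star> \<kappa>"

definition Z_function ::
    "('a::order \<Rightarrow> 'a \<Rightarrow> nat) \<Rightarrow> 'a interval_map \<Rightarrow> 'a interval_map \<Rightarrow> 'a interval_map" where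
  "Z_function \<rho> f g = inc_rev \<rho> g \<star> f"

definition right_augmented_Chow_function ::
    "('a::order \<Rightarrow> 'a \<Rightarrow> nat) \<Rightarrow> 'a interval_map \<Rightarrow> 'a interval_map \<Rightarrow> 'a interval_map" where
  "right_augmented_Chow_function \<rho> \<kappa> f = Chow_function \<kappa> \<star> inc_rev \<rho> f"

definition left_augmented_Chow_function ::
    "('a::order \<Rightarrow> 'a \<Rightarrow> nat) \<Rightarrow> 'a interval_map \<Rightarrow> 'a interval_map \<Rightarrow> 'a interval_map" where
  "left_augmented_Chow_function \<rho> \<kappa> g = inc_rev \<rho> g \<star> Chow_function \<kappa>"

definition nonneg_coeffs :: "int poly \<Rightarrow> bool" where
  "nonneg_coeffs p \<longleftrightarrow> (\<forall>i. 0 \<le> coeff p i)"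

text \<open>Unimodality includes non-negativity of the coefficients, being a property of polynomials
  with non-negative coefficients only.\<close>

definition unimodal :: "int poly \<Rightarrow> bool" where
  "unimodal p \<longleftrightarrow> nonneg_coeffs p \<and>
     (\<exists>j\<le>degree p. (\<forall>i<j. coeff p i \<le> coeff p (Suc i)) \<and>
                   (\<forall>i. j \<le> i \<and> i < degree p \<longrightarrow> coeff p (Suc i) \<le> coeff p i))"

end

theory Submission imports Defs begin

text \<open>
  Put \<open>D = \<kappa>' \<star> f\<close> and \<open>E = g \<star> \<kappa>'\<close>, where \<open>\<kappa>'\<close> is the reduced kernel. The diagonal entries of
  both are \<open>-1\<close>, and the defining equations of the KLS functions give, for \<open>s < t\<close>,
  \<open>(x - 1) D s t = f\<^sup>r\<^sup>e\<^sup>v s t - x f s t\<close> and likewise for \<open>E\<close> and \<open>g\<close>. As \<open>f s t\<close> has degree less than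
  \<open>\<rho> s t / 2\<close>, the quotient is a combination, with the coefficients of \<open>f s t\<close>, of polynomials
  \<open>x^(i+1) + \<dots> + x^(\<rho> s t - i - 1)\<close>. From \<open>H \<star> D = - f\<close> and \<open>E \<star> H = - g\<close> one obtains
  \<open>E \<star> F = - Z\<close> and \<open>G \<star> D = - Z\<close>. Read as recursions over intervals, the first two equations give
  the non-negativity of \<open>H\<close>, hence of \<open>F\<close> and \<open>G\<close>, and the last two give unimodality, because
  products of symmetric unimodal polynomials are symmetric unimodal and \<open>Z\<close> is symmetric.
\<close>

section \<open>Symmetric unimodal polynomials\<close>

text \<open>Indices range over all integers, with value 0 at negative ones, so that the reflection
  from \<open>k\<close> to \<open>n - k\<close> and shifts by \<open>j\<close> avoid truncated
  subtraction.\<close>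

definition int_coeff :: "int poly \<Rightarrow> int \<Rightarrow> int" where
  "int_coeff p k = (if k < 0 then 0 else coeff p (nat k))"

lemma int_coeff_of_nat [simp]: "int_coeff p (int i) = coeff p i"
  by (simp add: int_coeff_def)

lemma int_coeff_neg [simp]: "k < 0 \<Longrightarrow> int_coeff p k = 0"
  by (simp add: int_coeff_def)

lemma int_coeff_add [simp]: "int_coeff (p + q) k = int_coeff p k + int_coeff q k"
  by (simp add: int_coeff_def)

lemma int_coeff_sum: "int_coeff (sum h A) k = (\<Sum>i\<in>A. int_coeff (h i) k)"
  by (simp add: int_coeff_def coeff_sum)

lemma int_coeff_smult [simp]: "int_coeff (smult c p) k = c * int_coeff p k"
  by (simp add: int_coeff_def)

lemma int_coeff_monom_mult [simp]: "int_coeff (monom 1 j * p) k = int_coeff p (k - int j)"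
  by (auto simp: int_coeff_def coeff_monom_mult nat_diff_distrib)

lemma poly_eqI_int_coeff: "(\<And>k. int_coeff p k = int_coeff q k) \<Longrightarrow> p = q"
  by (rule poly_eqI) (metis int_coeff_of_nat)

lemma nonneg_coeffs_iff_int_coeff: "nonneg_coeffs p \<longleftrightarrow> (\<forall>k. 0 \<le> int_coeff p k)"
  unfolding nonneg_coeffs_def int_coeff_def by (metis nat_int of_nat_less_0_iff order_refl)

text \<open>Symmetry forces the degree to be at most \<open>n\<close>, and monotonicity starting from the zero
  coefficients of negative index forces non-negativity.\<close>

definition symmetric_unimodal :: "nat \<Rightarrow> int poly \<Rightarrow> bool" where
  "symmetric_unimodal n p \<longleftrightarrow>
     (\<forall>k. int_coeff p (int n - k) = int_coeff p k) \<and>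
     (\<forall>k. 2 * k + 1 \<le> int n \<longrightarrow> int_coeff p k \<le> int_coeff p (k + 1))"

lemma symmetric_unimodal_zero: "symmetric_unimodal n 0"
  by (simp add: symmetric_unimodal_def int_coeff_def)

lemma symmetric_unimodal_add:
  "symmetric_unimodal n p \<Longrightarrow> symmetric_unimodal n q \<Longrightarrow> symmetric_unimodal n (p + q)"
  by (simp add: symmetric_unimodal_def add_mono)

lemma symmetric_unimodal_sum:
  "(\<And>i. i \<in> A \<Longrightarrow> symmetric_unimodal n (h i)) \<Longrightarrow> symmetric_unimodal n (sum h A)"
  by (induction A rule: infinite_finite_induct)
    (simp_all add: symmetric_unimodal_zero symmetric_unimodal_add)

lemma symmetric_unimodal_smult:
  "0 \<le> c \<Longrightarrow> symmetric_unimodal n p \<Longrightarrow> symmetric_unimodal n (smult c p)"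
  by (simp add: symmetric_unimodal_def mult_left_mono)

text \<open>The hypotheses place \<open>b\<close> left of the centre \<open>n / 2\<close> and at
  least as far from it as \<open>a\<close>. If \<open>a\<close> lies beyond the centre, reflecting
  it to \<open>n - a\<close> leaves a chain of increases.\<close>

lemma symmetric_unimodal_le:
  assumes su: "symmetric_unimodal n p" and ab: "b \<le> a" "a + b \<le> int n"
  shows "int_coeff p b \<le> int_coeff p a"
proof -
  \<comment> \<open>For odd \<open>n\<close>, the bound \<open>n + 1\<close> admits the step between
    the two central indices.\<close>
  have chain: "int_coeff p b \<le> int_coeff p c" if "b \<le> c" "2 * c \<le> int n + 1" for c
    using that
  proof (induction c rule: int_ge_induct)
    case (step i)
    then have "int_coeff p i \<le> int_coeff p (i + 1)"
      using su by (simp add: symmetric_unimodal_def)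
    with step show ?case by simp
  qed simp
  show ?thesis
  proof (cases "2 * a \<le> int n + 1")
    case True
    then show ?thesis using chain ab by blast
  next
    case False
    then have "int_coeff p b \<le> int_coeff p (int n - a)"
      using ab by (intro chain) auto
    then show ?thesis using su by (simp add: symmetric_unimodal_def)
  qed
qed

lemma symmetric_unimodal_imp_nonneg:
  assumes "symmetric_unimodal n p"
  shows "nonneg_coeffs p"
  unfolding nonneg_coeffs_iff_int_coeff
proof
  fix k
  \<comment> \<open>The first index is negative, so its coefficient is 0, and it is at most
    \<open>k\<close> and \<open>n - k\<close>, as the comparison requires.\<close>
  have "int_coeff p (min k (min (- 1) (int n - k))) \<le> int_coeff p k"
    by (rule symmetric_unimodal_le[OF assms]) auto
  then show "0 \<le> int_coeff p k" by simp
qed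

lemma symmetric_unimodal_imp_unimodal:
  assumes su: "symmetric_unimodal n p"
  shows "unimodal p"
proof -
  have sym: "int_coeff p (int n - k) = int_coeff p k" for k
    using su by (simp add: symmetric_unimodal_def)
  have "\<exists>j\<le>degree p. (\<forall>i<j. coeff p i \<le> coeff p (Suc i)) \<and>
      (\<forall>i. j \<le> i \<and> i < degree p \<longrightarrow> coeff p (Suc i) \<le> coeff p i)"
  proof (cases "p = 0")
    case False
    \<comment> \<open>The peak \<open>n div 2\<close> must not exceed the degree: otherwise symmetry
      moves the leading coefficient above the degree, where it vanishes.\<close>
    have deg: "n div 2 \<le> degree p"
    proof (rule ccontr)
      assume "\<not> n div 2 \<le> degree p"
      then have less: "degree p < n - degree p" "degree p \<le> n" by linarith+
      then have "coeff p (n - degree p) = 0"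
        by (intro coeff_eq_0)
      then have "lead_coeff p = 0"
        using sym[of "int (degree p)"] less by (simp flip: of_nat_diff)
      with False show False by simp
    qed
    have up: "coeff p i \<le> coeff p (Suc i)" if "i < n div 2" for i
      using symmetric_unimodal_le[OF su, of "int i" "int (Suc i)"] that
      unfolding int_coeff_of_nat by linarith
    have down: "coeff p (Suc i) \<le> coeff p i" if "n div 2 \<le> i" for i
    proof -
      have "int_coeff p (int n - int (Suc i)) \<le> int_coeff p (int i)"
        by (rule symmetric_unimodal_le[OF su]) (use that in linarith)+
      then show ?thesis unfolding sym int_coeff_of_nat .
    qed
    show ?thesis using deg up down by blast
  qed simp
  then show ?thesis
    using symmetric_unimodal_imp_nonneg[OF su] by (simp add: unimodal_def)
qed

text \<open>The given peak \<open>j\<close> need not be central. Below \<open>j\<close> the increase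
  is part of unimodality; from \<open>j\<close> on, symmetry lets the decrease be read
  backwards.\<close>

lemma unimodal_imp_symmetric_unimodal:
  assumes um: "unimodal p" and sym: "\<And>k. int_coeff p (int n - k) = int_coeff p k"
  shows "symmetric_unimodal n p"
proof -
  obtain j where nn: "nonneg_coeffs p"
    and up: "\<And>i. i < j \<Longrightarrow> coeff p i \<le> coeff p (Suc i)"
    and down': "\<And>i. j \<le> i \<Longrightarrow> i < degree p \<Longrightarrow> coeff p (Suc i) \<le> coeff p i"
    using um unfolding unimodal_def by blast
  have down: "coeff p (Suc i) \<le> coeff p i" if "j \<le> i" for i
    using down'[OF that] nn by (cases "i < degree p") (auto simp: nonneg_coeffs_def coeff_eq_0)
  have chain: "coeff p l \<le> coeff p i" if "j \<le> i" "i \<le> l" for i l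
    using that(2)
  proof (induction l rule: dec_induct)
    case (step m)
    then show ?case using down[of m] that(1) by simp
  qed simp
  have "int_coeff p k \<le> int_coeff p (k + 1)" if k: "2 * k + 1 \<le> int n" for k
  proof (cases "k < 0")
    case True
    then show ?thesis using nn by (simp add: nonneg_coeffs_iff_int_coeff)
  next
    case False
    then obtain i where i: "k = int i" by (metis nonneg_int_cases not_less)
    show ?thesis
    proof (cases "i < j")
      case True
      then show ?thesis using up[OF True] int_coeff_of_nat[of p "Suc i"] by (simp add: i add.commute)
    next
      case False
      \<comment> \<open>Here \<open>j \<le> i + 1 \<le> n - i\<close>, and by symmetry the
        coefficient at \<open>n - i\<close> is the one at \<open>i\<close>.\<close>
      have "coeff p (n - i) \<le> coeff p (Suc i)"
        by (rule chain) (use False k i in linarith)+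
      moreover have "int (n - i) = int n - k" using k i by linarith
      ultimately show ?thesis
        using sym[of k] int_coeff_of_nat[of p "n - i"] int_coeff_of_nat[of p "Suc i"]
        by (simp add: i add.commute)
    qed
  qed
  then show ?thesis using sym by (simp add: symmetric_unimodal_def)
qed

section \<open>Products with monomials and geometric sums; the parameter \<open>n\<close> is twice
  the centre of symmetry\<close>

lemma symmetric_unimodal_monom_mult:
  assumes "symmetric_unimodal n p"
  shows "symmetric_unimodal (n + 2 * j) (monom 1 j * p)"
  unfolding symmetric_unimodal_def int_coeff_monom_mult
proof (intro conjI allI impI)
  fix k
  have "int_coeff p (int n - (k - int j)) = int_coeff p (k - int j)"
    using assms by (simp add: symmetric_unimodal_def)
  then show "int_coeff p (int (n + 2 * j) - k - int j) = int_coeff p (k - int j)"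
    by (simp add: algebra_simps)
next
  fix k assume "2 * k + 1 \<le> int (n + 2 * j)"
  then show "int_coeff p (k - int j) \<le> int_coeff p (k + 1 - int j)"
    by (intro symmetric_unimodal_le[OF assms]) auto
qed

definition geom_poly :: "nat \<Rightarrow> int poly" where
  "geom_poly l = (\<Sum>j<l. monom 1 j)"

lemma geom_poly_mult: "[:-1, 1:] * geom_poly l = monom 1 l - 1"
proof (induction l)
  case (Suc l)
  have "[:-1, 1:] * monom 1 l = monom 1 (Suc l) - (monom 1 l :: int poly)"
    by (simp add: monom_Suc)
  with Suc show ?case by (simp add: geom_poly_def distrib_left)
qed (simp add: geom_poly_def)

lemma int_coeff_geom_poly_mult:
  "int_coeff (geom_poly l * p) k = (\<Sum>j<l. int_coeff p (k - int j))"
  by (simp add: geom_poly_def sum_distrib_right int_coeff_sum)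

text \<open>Passing from index \<open>k\<close> to \<open>k + 1\<close>, a window of length \<open>Suc l\<close> loses its last coefficient and
  gains a new one; below the middle the gained one is closer to the centre.\<close>

lemma symmetric_unimodal_geom_poly_mult:
  assumes su: "symmetric_unimodal n p"
  shows "symmetric_unimodal (n + l) (geom_poly (Suc l) * p)"
  unfolding symmetric_unimodal_def int_coeff_geom_poly_mult
proof (intro conjI allI impI)
  fix k
  have "(\<Sum>j<Suc l. int_coeff p (int (n + l) - k - int j))
      = (\<Sum>j<Suc l. int_coeff p (int (n + l) - k - int (l - j)))"
    by (subst sum.nat_diff_reindex[symmetric]) simp
  also have "\<dots> = (\<Sum>j<Suc l. int_coeff p (k - int j))"
  proof (rule sum.cong)
    fix j assume "j \<in> {..<Suc l}"
    then have window: "int (n + l) - k - int (l - j) = int n - (k - int j)" by auto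
    show "int_coeff p (int (n + l) - k - int (l - j)) = int_coeff p (k - int j)"
      unfolding window using su unfolding symmetric_unimodal_def by blast
  qed simp
  finally show "(\<Sum>j<Suc l. int_coeff p (int (n + l) - k - int j))
      = (\<Sum>j<Suc l. int_coeff p (k - int j))" .
next
  fix k assume k: "2 * k + 1 \<le> int (n + l)"
  have "(\<Sum>j<Suc l. int_coeff p (k + 1 - int j))
      = int_coeff p (k + 1) + (\<Sum>j<l. int_coeff p (k - int j))"
    by (subst sum.lessThan_Suc_shift) simp
  moreover have "int_coeff p (k - int l) \<le> int_coeff p (k + 1)"
    by (rule symmetric_unimodal_le[OF su]) (use k in auto)
  ultimately show "(\<Sum>j<Suc l. int_coeff p (k - int j)) \<le> (\<Sum>j<Suc l. int_coeff p (k + 1 - int j))"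
    by simp
qed

section \<open>Reversal of polynomials\<close>

text \<open>Single-polynomial form of \<open>inc_rev\<close>: it is x^n p(1/x) as soon as
  \<open>n\<close> bounds the degree.\<close>

definition rev_poly :: "nat \<Rightarrow> int poly \<Rightarrow> int poly" where
  "rev_poly n p = monom 1 (n - degree p) * reflect_poly p"

lemma inc_rev_eq_rev_poly: "inc_rev \<rho> a s t = rev_poly (\<rho> s t) (a s t)"
  by (simp add: inc_rev_def rev_poly_def)

lemma int_coeff_rev_poly:
  assumes "degree p \<le> n"
  shows "int_coeff (rev_poly n p) k = int_coeff p (int n - k)"
proof (cases "0 \<le> k \<and> k \<le> int n")
  case True
  then obtain i where i: "k = int i" "i \<le> n" by (metis nonneg_int_cases of_nat_le_iff)
  have "coeff (rev_poly n p) i = coeff p (n - i)"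
    using assms i by (auto simp: rev_poly_def coeff_monom_mult coeff_reflect_poly coeff_eq_0)
  then show ?thesis using i by (simp flip: of_nat_diff)
next
  case False
  then show ?thesis
    using assms
    by (auto simp: int_coeff_def rev_poly_def coeff_monom_mult coeff_reflect_poly coeff_eq_0)
qed

lemma degree_rev_poly: "degree p \<le> n \<Longrightarrow> degree (rev_poly n p) \<le> n"
  by (rule degree_le)
    (auto simp: rev_poly_def coeff_monom_mult coeff_reflect_poly)

lemma rev_poly_rev_poly: "degree p \<le> n \<Longrightarrow> rev_poly n (rev_poly n p) = p"
  by (rule poly_eqI_int_coeff) (simp add: int_coeff_rev_poly degree_rev_poly)

lemma rev_poly_mult:
  assumes "degree p \<le> m" "degree q \<le> n"
  shows "rev_poly (m + n) (p * q) = rev_poly m p * rev_poly n q"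
proof (cases "p = 0 \<or> q = 0")
  case False
  have "m + n - (degree p + degree q) = (m - degree p) + (n - degree q)"
    using assms by simp
  then have "(monom 1 (m + n - (degree p + degree q)) :: int poly)
      = monom 1 (m - degree p) * monom 1 (n - degree q)"
    by (simp add: mult_monom)
  then show ?thesis
    using False by (simp add: rev_poly_def degree_mult_eq reflect_poly_mult)
qed (auto simp: rev_poly_def)

text \<open>The value at 1 is the sum of the coefficients, which does not depend on their
  order.\<close>

lemma poly_rev_poly_1: "poly (rev_poly n p) 1 = poly p 1"
proof -
  have "poly (Poly xs) 1 = sum_list xs" for xs :: "int list"
    by (induction xs) auto
  from this[of "coeffs p"] this[of "rev (coeffs p)"] show ?thesis
    by (simp add: rev_poly_def poly_monom reflect_poly_def)
qed

lemma nonneg_coeffs_rev_poly: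
  "degree p \<le> n \<Longrightarrow> nonneg_coeffs p \<Longrightarrow> nonneg_coeffs (rev_poly n p)"
  by (simp add: nonneg_coeffs_iff_int_coeff int_coeff_rev_poly)

lemma nonneg_coeffs_add: "nonneg_coeffs p \<Longrightarrow> nonneg_coeffs q \<Longrightarrow> nonneg_coeffs (p + q)"
  by (simp add: nonneg_coeffs_def)

lemma nonneg_coeffs_mult: "nonneg_coeffs p \<Longrightarrow> nonneg_coeffs q \<Longrightarrow> nonneg_coeffs (p * q)"
  by (simp add: nonneg_coeffs_def coeff_mult sum_nonneg)

lemma nonneg_coeffs_sum:
  "(\<And>i. i \<in> A \<Longrightarrow> nonneg_coeffs (h i)) \<Longrightarrow> nonneg_coeffs (sum h A)"
  by (simp add: nonneg_coeffs_def coeff_sum sum_nonneg)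

text \<open>The quotient \<open>(x^n p(1/x) - x p(x)) / (x - 1)\<close>, written out as a combination of the
  polynomials \<open>x^(i+1) + \<dots> + x^(n-i-1)\<close>.\<close>

definition rev_quotient :: "nat \<Rightarrow> int poly \<Rightarrow> int poly" where
  "rev_quotient n p =
     (\<Sum>i\<le>degree p. smult (coeff p i) (monom 1 (Suc i) * geom_poly (n - Suc (2 * i))))"

text \<open>By telescoping, x - 1 times x^(i+1) + ... + x^(n-i-1) is x^(n-i) - x^(i+1); weighting by
  the coefficients of \<open>p\<close> and summing gives both terms.\<close>

lemma rev_quotient_mult:
  assumes "2 * degree p < n"
  shows "[:-1, 1:] * rev_quotient n p = rev_poly n p - monom 1 1 * p"
proof -
  have p: "(\<Sum>i\<le>degree p. smult (coeff p i) (monom 1 i)) = p"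
    by (simp add: smult_monom poly_as_sum_of_monoms)
  have rev: "rev_poly n p = (\<Sum>i\<le>degree p. smult (coeff p i) (monom 1 (n - i)))"
  proof (rule poly_eqI)
    fix k
    have "coeff (rev_poly n p) k = (if k \<le> n then coeff p (n - k) else 0)"
      using assms by (auto simp: rev_poly_def coeff_monom_mult coeff_reflect_poly coeff_eq_0)
    also have "\<dots> = (\<Sum>i\<le>degree p. if i = n - k \<and> k \<le> n then coeff p i else 0)"
      by (auto simp: sum.delta coeff_eq_0)
    also have "\<dots> = (\<Sum>i\<le>degree p. coeff (smult (coeff p i) (monom 1 (n - i))) k)"
      using assms by (intro sum.cong) auto
    finally show "coeff (rev_poly n p) k
        = coeff (\<Sum>i\<le>degree p. smult (coeff p i) (monom 1 (n - i))) k"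
      by (simp add: coeff_sum)
  qed
  have "[:-1, 1:] * rev_quotient n p
      = (\<Sum>i\<le>degree p. smult (coeff p i) (monom 1 (n - i) - monom 1 1 * monom 1 i))"
    unfolding rev_quotient_def sum_distrib_left
  proof (rule sum.cong)
    fix i assume "i \<in> {..degree p}"
    \<comment> \<open>The degree bound gives \<open>2 * i < n\<close>, so the natural subtraction is
      exact.\<close>
    then have i: "Suc i + (n - Suc (2 * i)) = n - i" using assms by auto
    have "[:-1, 1:] * (monom 1 (Suc i) * geom_poly (n - Suc (2 * i)))
        = monom 1 (Suc i) * ([:-1, 1:] * geom_poly (n - Suc (2 * i)))"
      by (rule mult.left_commute)
    also have "\<dots> = monom 1 (n - i) - monom 1 1 * monom 1 i"
      unfolding geom_poly_mult right_diff_distrib mult_monom i by simp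
    finally show "[:-1, 1:] * smult (coeff p i) (monom 1 (Suc i) * geom_poly (n - Suc (2 * i)))
        = smult (coeff p i) (monom 1 (n - i) - monom 1 1 * monom 1 i)"
      by (simp only: mult_smult_right)
  qed simp
  also have "\<dots> = rev_poly n p - monom 1 1 * (\<Sum>i\<le>degree p. smult (coeff p i) (monom 1 i))"
    unfolding rev smult_diff_right sum_subtractf sum_distrib_left mult_smult_right ..
  finally show ?thesis unfolding p .
qed

lemma nonneg_coeffs_rev_quotient: "nonneg_coeffs p \<Longrightarrow> nonneg_coeffs (rev_quotient n p)"
  unfolding rev_quotient_def
  by (rule nonneg_coeffs_sum)
    (simp add: nonneg_coeffs_def coeff_monom_mult geom_poly_def coeff_sum sum_nonneg)

text \<open>Every window is centred at \<open>n / 2\<close>, whatever \<open>i\<close> is. Hence all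
  products with \<open>q\<close> share the centre \<open>(n + m) / 2\<close> and can be added with
  non-negative weights.\<close>

lemma symmetric_unimodal_rev_quotient_mult:
  assumes p: "nonneg_coeffs p" "2 * degree p < n" and q: "symmetric_unimodal m q"
  shows "symmetric_unimodal (n + m) (rev_quotient n p * q)"
proof -
  have "symmetric_unimodal (n + m) (monom 1 (Suc i) * (geom_poly (n - Suc (2 * i)) * q))"
    if i: "i \<le> degree p" for i
  proof (cases "n - Suc (2 * i)")
    \<comment> \<open>The window x^(i+1) + ... + x^(n-i-1) is empty; this happens for
      \<open>n = 2 * i + 1\<close>.\<close>
    case 0
    then show ?thesis by (simp add: geom_poly_def symmetric_unimodal_zero)
  next
    case (Suc l)
    have "n + m = m + l + 2 * Suc i" using Suc by simp
    then show ?thesis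
      using symmetric_unimodal_monom_mult[OF symmetric_unimodal_geom_poly_mult[OF q], of l "Suc i"]
      by (simp only: Suc)
  qed
  then show ?thesis
    unfolding rev_quotient_def sum_distrib_right mult_smult_left mult.assoc
    using p(1) by (intro symmetric_unimodal_sum symmetric_unimodal_smult)
      (auto simp: nonneg_coeffs_def)
qed

section \<open>The incidence algebra\<close>

lemma inc_mult_assoc:
  fixes a b c :: "('a::order) interval_map"
  assumes "\<And>s t :: 'a. finite {s..t}"
  shows "(a \<star> b) \<star> c = a \<star> (b \<star> c)"
proof (intro ext)
  fix s t
  have "((a \<star> b) \<star> c) s t = (\<Sum>(w, u)\<in>(SIGMA w:{s..t}. {s..w}). a s u * b u w * c w t)"
    by (simp add: inc_mult_def sum_distrib_right sum.Sigma assms)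
  also have "\<dots> = (\<Sum>(u, w)\<in>(SIGMA u:{s..t}. {u..t}). a s u * b u w * c w t)"
    by (rule sum.reindex_bij_witness[of _ prod.swap prod.swap]) (auto intro: order_trans)
  also have "\<dots> = (a \<star> (b \<star> c)) s t"
    by (simp add: inc_mult_def sum_distrib_left sum.Sigma assms mult.assoc)
  finally show "((a \<star> b) \<star> c) s t = (a \<star> (b \<star> c)) s t" .
qed

lemma inc_mult_one:
  fixes a :: "('a::order) interval_map"
  assumes "\<And>s t :: 'a. finite {s..t}" and "a \<in> incidence_algebra"
  shows "inc_one \<star> a = a" "a \<star> inc_one = a"
  using assms(2)
  by (auto simp: fun_eq_iff inc_mult_def inc_one_def incidence_algebra_def if_distrib if_distribR
      assms(1) cong: if_cong)

lemma inc_mult_uminus: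
  "(- a) \<star> b = - (a \<star> b)" "a \<star> (- b) = - (a \<star> b)"
  by (simp_all add: fun_eq_iff inc_mult_def sum_negf)

lemma inc_mult_split_first:
  fixes a b :: "('a::order) interval_map"
  assumes "finite {s..t}" "s \<le> t"
  shows "(a \<star> b) s t = a s s * b s t + (\<Sum>w\<in>{s<..t}. a s w * b w t)"
proof -
  have "{s..t} = insert s {s<..t}" using assms(2) by (auto simp: order.order_iff_strict)
  then show ?thesis using assms by (simp add: inc_mult_def)
qed

lemma inc_mult_split_last:
  fixes a b :: "('a::order) interval_map"
  assumes "finite {s..t}" "s \<le> t"
  shows "(a \<star> b) s t = a s t * b t t + (\<Sum>w\<in>{s..<t}. a s w * b w t)"
proof -
  have "{s..t} = insert t {s..<t}" using assms(2) by (auto simp: order.order_iff_strict)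
  then show ?thesis using assms by (simp add: inc_mult_def)
qed

section \<open>Recursion over intervals and inverses\<close>

lemma card_interval_less:
  fixes s t :: "'a::order"
  assumes "finite {s..t}"
  shows "w \<in> {s<..t} \<Longrightarrow> card {w..t} < card {s..t}" "w \<in> {s..<t} \<Longrightarrow> card {s..w} < card {s..t}"
  by (rule psubset_card_mono[OF assms], force simp: subset_iff)+

text \<open>The finiteness test only serves termination.\<close>

function right_inverse :: "('a::order) interval_map \<Rightarrow> 'a interval_map" where
  "right_inverse a s t =
     (if \<not> s \<le> t \<or> infinite {s..t} then 0
      else a s s * ((if s = t then 1 else 0) - (\<Sum>w\<in>{s<..t}. a s w * right_inverse a w t)))"
  by pat_completeness auto
termination
  by (relation "measure (\<lambda>(a, s, t). card {s..t})") (auto intro!: card_interval_less)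

declare right_inverse.simps [simp del]

text \<open>Each diagonal entry is its own inverse, so the factor \<open>a s s\<close> in the
  recursion acts as division. The result inherits the diagonal, so the construction can be repeated
  on it.\<close>

lemma right_inverse:
  fixes a :: "('a::order) interval_map"
  assumes fin: "\<And>s t :: 'a. finite {s..t}" and diag: "\<And>s. a s s * a s s = 1"
  shows "right_inverse a \<in> incidence_algebra" "a \<star> right_inverse a = inc_one"
    "right_inverse a s s = a s s"
proof -
  show "right_inverse a \<in> incidence_algebra"
    by (simp add: incidence_algebra_def right_inverse.simps)
  show "right_inverse a s s = a s s"
    by (simp add: right_inverse.simps)
  have "(a \<star> right_inverse a) s t = inc_one s t" for s t
  proof (cases "s \<le> t")
    case True
    have "a s s * right_inverse a s t
        = a s s * a s s * ((if s = t then 1 else 0) - (\<Sum>w\<in>{s<..t}. a s w * right_inverse a w t))"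
      by (subst right_inverse.simps) (simp add: True fin mult.assoc)
    then show ?thesis
      unfolding inc_mult_split_first[OF fin True] diag by (simp add: inc_one_def)
  next
    case False
    then show ?thesis by (auto simp: inc_mult_def inc_one_def)
  qed
  then show "a \<star> right_inverse a = inc_one" by (intro ext)
qed

text \<open>Take a right inverse \<open>b\<close> of \<open>a\<close> and a right inverse
  \<open>c\<close> of \<open>b\<close>. Associativity of \<open>a \<star> b \<star> c\<close> gives
  \<open>a = c\<close>, so \<open>b\<close> is two-sided, and uniqueness evaluates the definite
  description.\<close>

lemma inc_inverse:
  fixes a :: "('a::order) interval_map"
  assumes fin: "\<And>s t :: 'a. finite {s..t}" and diag: "\<And>s. a s s * a s s = 1"
    and a: "a \<in> incidence_algebra"
  shows "inc_inverse a \<in> incidence_algebra" "a \<star> inc_inverse a = inc_one"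
    "inc_inverse a \<star> a = inc_one"
proof -
  define b where "b = right_inverse a"
  define c where "c = right_inverse b"
  have b: "b \<in> incidence_algebra" "a \<star> b = inc_one" "\<And>s. b s s * b s s = 1"
    unfolding b_def using right_inverse[of a, OF fin diag] diag by auto
  have c: "c \<in> incidence_algebra" "b \<star> c = inc_one"
    unfolding c_def using right_inverse[of b, OF fin b(3)] by auto
  have "a = c"
    using inc_mult_assoc[OF fin, of a b c] inc_mult_one[OF fin] a b c by simp
  with c have ba: "b \<star> a = inc_one" by simp
  have "b' = b" if "b' \<in> incidence_algebra" "b' \<star> a = inc_one" for b'
    using inc_mult_assoc[OF fin, of b' a b] inc_mult_one[OF fin] that b by simp
  then have "inc_inverse a = b"
    unfolding inc_inverse_def using b(1,2) ba by (intro the_equality conjI) blast+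
  with b ba show "inc_inverse a \<in> incidence_algebra" "a \<star> inc_inverse a = inc_one"
    "inc_inverse a \<star> a = inc_one" by simp_all
qed

section \<open>Induction along a convolution equation\<close>

lemma closed_add_sum:
  fixes x :: "'b::comm_monoid_add"
  assumes "Q x" "\<And>i. i \<in> A \<Longrightarrow> Q (h i)" "\<And>p q. Q p \<Longrightarrow> Q q \<Longrightarrow> Q (p + q)"
  shows "Q (x + sum h A)"
  using assms(2)
proof (induction A rule: infinite_finite_induct)
  case (insert i A)
  then have "Q (h i + (x + sum h A))" using assms(3) by blast
  then show ?case using insert by (simp add: add.left_commute)
qed (use assms(1) in auto)

text \<open>When \<open>D t t = - 1\<close>, the equation \<open>X \<star> D = - Y\<close> reads
  \<open>X s t = Y s t + (\<Sum>w\<in>{s..<t}. X s w * D w t)\<close>; similarly on the other side.\<close>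

lemma inc_mult_right_induct:
  fixes X D Y :: "('a::order) interval_map"
  assumes fin: "\<And>s t :: 'a. finite {s..t}" and eq: "X \<star> D = - Y" and diag: "\<And>t. D t t = - 1"
    and base: "\<And>s t. s \<le> t \<Longrightarrow> Q s t (Y s t)"
    and add: "\<And>s t p q. Q s t p \<Longrightarrow> Q s t q \<Longrightarrow> Q s t (p + q)"
    and mult: "\<And>s w t p. s \<le> w \<Longrightarrow> w < t \<Longrightarrow> Q s w p \<Longrightarrow> Q s t (p * D w t)"
    and "s \<le> t"
  shows "Q s t (X s t)"
  using \<open>s \<le> t\<close>
proof (induction "card {s..t}" arbitrary: t rule: less_induct)
  case less
  have "(X \<star> D) s t = - Y s t" by (simp add: eq)
  then have "X s t = Y s t + (\<Sum>w\<in>{s..<t}. X s w * D w t)"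
    unfolding inc_mult_split_last[OF fin less.prems] diag by (simp add: algebra_simps)
  \<comment> \<open>The sum is built up on top of \<open>Y s t\<close>, so \<open>Q\<close> is not
    asked to hold at 0.\<close>
  moreover have "Q s t (Y s t + (\<Sum>w\<in>{s..<t}. X s w * D w t))"
    using base less.prems
    by (intro closed_add_sum[where Q = "Q s t"] mult add less.hyps card_interval_less fin) auto
  ultimately show ?case by simp
qed

lemma inc_mult_left_induct:
  fixes X D Y :: "('a::order) interval_map"
  assumes fin: "\<And>s t :: 'a. finite {s..t}" and eq: "D \<star> X = - Y" and diag: "\<And>t. D t t = - 1"
    and base: "\<And>s t. s \<le> t \<Longrightarrow> Q s t (Y s t)"
    and add: "\<And>s t p q. Q s t p \<Longrightarrow> Q s t q \<Longrightarrow> Q s t (p + q)"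
    and mult: "\<And>s w t p. s < w \<Longrightarrow> w \<le> t \<Longrightarrow> Q w t p \<Longrightarrow> Q s t (D s w * p)"
    and "s \<le> t"
  shows "Q s t (X s t)"
  using \<open>s \<le> t\<close>
proof (induction "card {s..t}" arbitrary: s rule: less_induct)
  case less
  have "(D \<star> X) s t = - Y s t" by (simp add: eq)
  then have "X s t = Y s t + (\<Sum>w\<in>{s<..t}. D s w * X w t)"
    unfolding inc_mult_split_first[OF fin less.prems] diag by (simp add: algebra_simps)
  moreover have "Q s t (Y s t + (\<Sum>w\<in>{s<..t}. D s w * X w t))"
    using base less.prems
    by (intro closed_add_sum[where Q = "Q s t"] mult add less.hyps card_interval_less fin) auto
  ultimately show ?case by simp
qed

lemma nonneg_coeffs_inc_mult:
  assumes "\<And>s t. s \<le> t \<Longrightarrow> nonneg_coeffs (a s t)" "\<And>s t. s \<le> t \<Longrightarrow> nonneg_coeffs (b s t)"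
  shows "nonneg_coeffs ((a \<star> b) s t)"
  unfolding inc_mult_def using assms by (intro nonneg_coeffs_sum nonneg_coeffs_mult) auto

section \<open>Kernels and KLS functions\<close>

locale KLS =
  fixes \<rho> :: "'a::order \<Rightarrow> 'a \<Rightarrow> nat" and \<kappa> f g :: "'a interval_map"
  assumes fin: "\<And>s t :: 'a. finite {s..t}"
    and weak_rank: "weak_rank_function \<rho>"
    and kernel: "poset_kernel \<rho> \<kappa>"
    and right_KLS: "right_KLS_function \<rho> \<kappa> f"
    and left_KLS: "left_KLS_function \<rho> \<kappa> g"
begin

abbreviation H :: "'a interval_map" where "H \<equiv> Chow_function \<kappa>"

lemma rank_add: "s \<le> w \<Longrightarrow> w \<le> t \<Longrightarrow> \<rho> s t = \<rho> s w + \<rho> w t"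
  using weak_rank unfolding weak_rank_function_def by blast

lemma f_props:
  "f \<in> incidence_algebra" "f s s = 1" "s < t \<Longrightarrow> 2 * degree (f s t) < \<rho> s t"
  "s \<le> t \<Longrightarrow> degree (f s t) \<le> \<rho> s t" "inc_rev \<rho> f = \<kappa> \<star> f"
  using right_KLS by (auto simp: right_KLS_function_def bounded_incidence_algebra_def)

lemma g_props:
  "g \<in> incidence_algebra" "g s s = 1" "s < t \<Longrightarrow> 2 * degree (g s t) < \<rho> s t"
  "s \<le> t \<Longrightarrow> degree (g s t) \<le> \<rho> s t" "inc_rev \<rho> g = g \<star> \<kappa>"
  using left_KLS by (auto simp: left_KLS_function_def bounded_incidence_algebra_def)

lemma \<kappa>_props: "\<kappa> \<in> incidence_algebra" "\<kappa> s s = 1"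
  using kernel by (auto simp: poset_kernel_def bounded_incidence_algebra_def)

text \<open>Evaluating \<open>\<kappa> \<star> f = inc_rev \<rho> f\<close> at \<open>1\<close> shows that \<open>\<kappa>\<close> becomes the identity there.\<close>

lemma poly_\<kappa>_1: "s < t \<Longrightarrow> poly (\<kappa> s t) 1 = 0"
proof (induction "card {s..t}" arbitrary: t rule: less_induct)
  case less
  then have st: "s \<le> t" by simp
  have "poly ((\<kappa> \<star> f) s t) 1 = poly (f s t) 1"
    unfolding f_props(5)[symmetric] inc_rev_eq_rev_poly by (rule poly_rev_poly_1)
  \<comment> \<open>By induction only \<open>w = s\<close> contributes, with the value of
    \<open>f s t\<close> at 1. This is already the whole convolution, so the remaining term, from
    \<open>w = t\<close>, vanishes.\<close>
  moreover have "(\<Sum>w\<in>{s..<t}. poly (\<kappa> s w) 1 * poly (f w t) 1)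
      = (\<Sum>w\<in>{s..<t}. if w = s then poly (f w t) 1 else 0)"
  proof (rule sum.cong)
    fix w assume w: "w \<in> {s..<t}"
    then have "poly (\<kappa> s w) 1 = 0" if "w \<noteq> s"
      using that by (intro less.hyps card_interval_less fin) auto
    then show "poly (\<kappa> s w) 1 * poly (f w t) 1 = (if w = s then poly (f w t) 1 else 0)"
      by (simp add: \<kappa>_props)
  qed simp
  moreover have "finite {s..<t}"
    by (rule finite_subset[OF _ fin[of s t]]) auto
  ultimately show ?case
    using less.prems
    unfolding inc_mult_split_last[OF fin st]
    by (simp add: poly_sum f_props)
qed

text \<open>The diagonal value -1 fits because 1 = (x - 1)(-1) + x. Thus \<open>\<kappa>\<close> is
  x - 1 times the reduced kernel plus x times the identity.\<close>

lemma reduced_kernel_mult: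
  assumes "s \<le> t"
  shows "\<kappa> s t = [:-1, 1:] * reduced_kernel \<kappa> s t + (if s = t then monom 1 1 else 0)"
proof (cases "s = t")
  case True
  then show ?thesis by (simp add: \<kappa>_props reduced_kernel_def monom_altdef one_pCons)
next
  case False
  with assms have "s < t" by simp
  then have "[:-1, 1:] dvd \<kappa> s t"
    using poly_\<kappa>_1 by (simp add: poly_eq_0_iff_dvd)
  then have "[:-1, 1:] * (\<kappa> s t div [:-1, 1:]) = \<kappa> s t"
    by (rule dvd_mult_div_cancel)
  then show ?thesis
    using \<open>s < t\<close> False by (simp only: reduced_kernel_def if_False if_True add_0_right)
qed

lemma reduced_kernel_inverse:
  "inc_inverse (reduced_kernel \<kappa>) \<star> reduced_kernel \<kappa> = inc_one"
  "reduced_kernel \<kappa> \<star> inc_inverse (reduced_kernel \<kappa>) = inc_one"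
proof -
  have "reduced_kernel \<kappa> \<in> incidence_algebra"
    by (auto simp: reduced_kernel_def incidence_algebra_def)
  moreover have "reduced_kernel \<kappa> s s * reduced_kernel \<kappa> s s = 1" for s
    by (simp add: reduced_kernel_def)
  ultimately show "inc_inverse (reduced_kernel \<kappa>) \<star> reduced_kernel \<kappa> = inc_one"
    "reduced_kernel \<kappa> \<star> inc_inverse (reduced_kernel \<kappa>) = inc_one"
    using inc_inverse[of "reduced_kernel \<kappa>", OF fin] by blast+
qed

section \<open>The convolutions \<open>D\<close> and \<open>E\<close> and their equations\<close>

definition D :: "'a interval_map" where "D = reduced_kernel \<kappa> \<star> f"
definition E :: "'a interval_map" where "E = g \<star> reduced_kernel \<kappa>"

lemma D_E_diag: "D s s = - 1" "E s s = - 1"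
  by (simp_all add: D_def E_def inc_mult_def f_props g_props reduced_kernel_def)

lemma D_eq_rev_quotient:
  assumes "s < t"
  shows "D s t = rev_quotient (\<rho> s t) (f s t)"
proof -
  have st: "s \<le> t" using assms by simp
  \<comment> \<open>The extra x on the diagonal of \<open>\<kappa>\<close> contributes only at
    \<open>w = s\<close> and yields x times \<open>f s t\<close>.\<close>
  have "(\<kappa> \<star> f) s t = (\<Sum>w\<in>{s..t}. [:-1, 1:] * (reduced_kernel \<kappa> s w * f w t)
      + (if w = s then monom 1 1 * f w t else 0))"
    unfolding inc_mult_def by (rule sum.cong) (auto simp: reduced_kernel_mult algebra_simps)
  also have "\<dots> = [:-1, 1:] * D s t + monom 1 1 * f s t"
    unfolding sum.distrib D_def inc_mult_def sum_distrib_left[symmetric]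
    using st by (simp add: fin)
  finally have "[:-1, 1:] * D s t = rev_poly (\<rho> s t) (f s t) - monom 1 1 * f s t"
    unfolding f_props(5)[symmetric] inc_rev_eq_rev_poly by (simp only: add_diff_cancel_right')
  also have "\<dots> = [:-1, 1:] * rev_quotient (\<rho> s t) (f s t)"
    by (rule rev_quotient_mult[symmetric]) (rule f_props(3)[OF assms])
  finally show ?thesis
    using mult_left_cancel[of "[:-1, 1:] :: int poly"] by (metis pCons_eq_0_iff one_neq_zero)
qed

lemma E_eq_rev_quotient:
  assumes "s < t"
  shows "E s t = rev_quotient (\<rho> s t) (g s t)"
proof -
  have st: "s \<le> t" using assms by simp
  have "(g \<star> \<kappa>) s t = (\<Sum>w\<in>{s..t}. [:-1, 1:] * (g s w * reduced_kernel \<kappa> w t)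
      + (if w = t then monom 1 1 * g s w else 0))"
    unfolding inc_mult_def by (rule sum.cong) (auto simp: reduced_kernel_mult algebra_simps)
  also have "\<dots> = [:-1, 1:] * E s t + monom 1 1 * g s t"
    unfolding sum.distrib E_def inc_mult_def sum_distrib_left[symmetric]
    using st by (simp add: fin)
  finally have "[:-1, 1:] * E s t = rev_poly (\<rho> s t) (g s t) - monom 1 1 * g s t"
    unfolding g_props(5)[symmetric] inc_rev_eq_rev_poly by (simp only: add_diff_cancel_right')
  also have "\<dots> = [:-1, 1:] * rev_quotient (\<rho> s t) (g s t)"
    by (rule rev_quotient_mult[symmetric]) (rule g_props(3)[OF assms])
  finally show ?thesis
    using mult_left_cancel[of "[:-1, 1:] :: int poly"] by (metis pCons_eq_0_iff one_neq_zero)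
qed

lemma H_eq: "H = - inc_inverse (reduced_kernel \<kappa>)"
  by (simp add: fun_eq_iff Chow_function_def)

text \<open>\<open>H\<close> is minus the inverse of the reduced kernel, which cancels against the
  left factor of \<open>D\<close>.\<close>

lemma H_mult_D: "H \<star> D = - f"
  unfolding H_eq D_def inc_mult_uminus inc_mult_assoc[OF fin, symmetric] reduced_kernel_inverse
  by (simp only: inc_mult_one[OF fin] f_props)

lemma E_mult_H: "E \<star> H = - g"
  unfolding H_eq E_def inc_mult_uminus inc_mult_assoc[OF fin] reduced_kernel_inverse
  by (simp only: inc_mult_one[OF fin] g_props)

text \<open>By the two KLS equations, both sides are
  \<open>g \<star> \<kappa> \<star> f\<close>.\<close>

lemma Z_eq: "Z_function \<rho> f g = g \<star> inc_rev \<rho> f"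
  by (simp only: Z_function_def f_props g_props inc_mult_assoc[OF fin])

lemma E_mult_F: "E \<star> right_augmented_Chow_function \<rho> \<kappa> f = - Z_function \<rho> f g"
  unfolding right_augmented_Chow_function_def inc_mult_assoc[OF fin, symmetric] E_mult_H
    inc_mult_uminus Z_eq ..

lemma G_mult_D: "left_augmented_Chow_function \<rho> \<kappa> g \<star> D = - Z_function \<rho> f g"
  unfolding left_augmented_Chow_function_def inc_mult_assoc[OF fin] H_mult_D
    inc_mult_uminus Z_function_def ..

text \<open>Additivity of the rank makes reversal multiplicative, so it turns each term of
  \<open>inc_rev \<rho> g \<star> f\<close> into the corresponding term of
  \<open>g \<star> inc_rev \<rho> f\<close>; both sums are \<open>Z\<close>.\<close>

lemma Z_symmetric:
  assumes "s \<le> t"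
  shows "int_coeff (Z_function \<rho> f g s t) (int (\<rho> s t) - k) = int_coeff (Z_function \<rho> f g s t) k"
proof -
  have "int_coeff (inc_rev \<rho> g s w * f w t) (int (\<rho> s t) - k)
      = int_coeff (g s w * inc_rev \<rho> f w t) k" if w: "s \<le> w" "w \<le> t" for w
  proof -
    let ?p = "rev_poly (\<rho> s w) (g s w) * f w t"
    have deg: "degree (rev_poly (\<rho> s w) (g s w)) \<le> \<rho> s w" "degree (f w t) \<le> \<rho> w t"
      using w by (simp_all add: degree_rev_poly g_props f_props)
    then have "degree ?p \<le> \<rho> s t"
      using degree_mult_le[of "rev_poly (\<rho> s w) (g s w)" "f w t"] rank_add[OF w] by simp
    then have "int_coeff ?p (int (\<rho> s t) - k) = int_coeff (rev_poly (\<rho> s t) ?p) k"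
      by (simp add: int_coeff_rev_poly)
    also have "rev_poly (\<rho> s t) ?p = g s w * rev_poly (\<rho> w t) (f w t)"
      using w by (simp add: rank_add[OF w] rev_poly_mult[OF deg] rev_poly_rev_poly g_props)
    finally show ?thesis by (simp add: inc_rev_eq_rev_poly)
  qed
  then have "int_coeff ((inc_rev \<rho> g \<star> f) s t) (int (\<rho> s t) - k)
      = int_coeff ((g \<star> inc_rev \<rho> f) s t) k"
    unfolding inc_mult_def int_coeff_sum by (intro sum.cong) auto
  then show ?thesis using Z_eq by (simp add: Z_function_def)
qed

section \<open>Non-negativity and unimodality of the augmented Chow functions\<close>

lemma nonneg_F:
  assumes f: "\<And>s t. s \<le> t \<Longrightarrow> nonneg_coeffs (f s t)"
  shows "nonneg_coeffs (right_augmented_Chow_function \<rho> \<kappa> f s t)"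
proof -
  \<comment> \<open>The recursion builds \<open>H\<close> from \<open>f\<close> and the quotients
    \<open>D w t\<close>, whose coefficients are sums of coefficients of \<open>f\<close>.\<close>
  have "nonneg_coeffs (H s t)" if "s \<le> t" for s t
    by (rule inc_mult_right_induct[where Q = "\<lambda>_ _. nonneg_coeffs", OF fin H_mult_D D_E_diag(1)])
      (simp_all add: f that nonneg_coeffs_add nonneg_coeffs_mult D_eq_rev_quotient
        nonneg_coeffs_rev_quotient)
  then show ?thesis
    unfolding right_augmented_Chow_function_def
    by (rule nonneg_coeffs_inc_mult)
      (simp_all add: inc_rev_eq_rev_poly nonneg_coeffs_rev_poly f_props(4) f)
qed

lemma nonneg_G:
  assumes g: "\<And>s t. s \<le> t \<Longrightarrow> nonneg_coeffs (g s t)"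
  shows "nonneg_coeffs (left_augmented_Chow_function \<rho> \<kappa> g s t)"
proof -
  have "nonneg_coeffs (H s t)" if "s \<le> t" for s t
    by (rule inc_mult_left_induct[where Q = "\<lambda>_ _. nonneg_coeffs", OF fin E_mult_H D_E_diag(2)])
      (simp_all add: g that nonneg_coeffs_add nonneg_coeffs_mult E_eq_rev_quotient
        nonneg_coeffs_rev_quotient)
  then show ?thesis
    unfolding left_augmented_Chow_function_def
    by (intro nonneg_coeffs_inc_mult)
      (simp_all add: inc_rev_eq_rev_poly nonneg_coeffs_rev_poly g_props(4) g)
qed

text \<open>Unimodality alone does not survive addition, so the induction carries symmetry along:
  the terms \<open>E s w * F w t\<close> added to \<open>Z s t\<close> have the same centre, since
  \<open>\<rho> s w + \<rho> w t = \<rho> s t\<close>.\<close>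

lemma unimodal_F:
  assumes Z: "\<And>s t. s \<le> t \<Longrightarrow> unimodal (Z_function \<rho> f g s t)"
    and g: "\<And>s t. s \<le> t \<Longrightarrow> nonneg_coeffs (g s t)" and st: "s \<le> t"
  shows "unimodal (right_augmented_Chow_function \<rho> \<kappa> f s t)"
proof (rule symmetric_unimodal_imp_unimodal,
    rule inc_mult_left_induct[where Q = "\<lambda>s t. symmetric_unimodal (\<rho> s t)",
      OF fin E_mult_F D_E_diag(2) _ _ _ st])
  show "symmetric_unimodal (\<rho> s t) (Z_function \<rho> f g s t)" if "s \<le> t" for s t
    using that by (intro unimodal_imp_symmetric_unimodal Z Z_symmetric)
  show "symmetric_unimodal (\<rho> s t) (E s w * p)"
    if "s < w" "w \<le> t" "symmetric_unimodal (\<rho> w t) p" for s w t p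
    using that
    by (simp add: rank_add[of s w t] E_eq_rev_quotient symmetric_unimodal_rev_quotient_mult g
        g_props)
qed (rule symmetric_unimodal_add)

lemma unimodal_G:
  assumes Z: "\<And>s t. s \<le> t \<Longrightarrow> unimodal (Z_function \<rho> f g s t)"
    and f: "\<And>s t. s \<le> t \<Longrightarrow> nonneg_coeffs (f s t)" and st: "s \<le> t"
  shows "unimodal (left_augmented_Chow_function \<rho> \<kappa> g s t)"
proof (rule symmetric_unimodal_imp_unimodal,
    rule inc_mult_right_induct[where Q = "\<lambda>s t. symmetric_unimodal (\<rho> s t)",
      OF fin G_mult_D D_E_diag(1) _ _ _ st])
  show "symmetric_unimodal (\<rho> s t) (Z_function \<rho> f g s t)" if "s \<le> t" for s t
    using that by (intro unimodal_imp_symmetric_unimodal Z Z_symmetric)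
  show "symmetric_unimodal (\<rho> s t) (p * D w t)"
    if "s \<le> w" "w < t" "symmetric_unimodal (\<rho> s w) p" for s w t p
    \<comment> \<open>The product lemma has the quotient on the left; commutativity swaps the
      factors and the two ranks.\<close>
    using that symmetric_unimodal_rev_quotient_mult[OF f f_props(3), of w t "\<rho> s w" p]
    by (simp add: rank_add[of s w t] D_eq_rev_quotient mult.commute add.commute)
qed (rule symmetric_unimodal_add)

end

theorem theorem3p17:
  fixes \<rho> :: "'a::order \<Rightarrow> 'a \<Rightarrow> nat"
    and \<kappa> f g Z F G :: "'a \<Rightarrow> 'a \<Rightarrow> int poly"
  assumes "\<And>s t :: 'a. finite {s..t}"
    and "weak_rank_function \<rho>"
    and "poset_kernel \<rho> \<kappa>"
    and "right_KLS_function \<rho> \<kappa> f"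
    and "left_KLS_function \<rho> \<kappa> g"
    and "Z = Z_function \<rho> f g"
    and "F = right_augmented_Chow_function \<rho> \<kappa> f"
    and "G = left_augmented_Chow_function \<rho> \<kappa> g"
  shows
    "((\<forall>s t. s \<le> t \<longrightarrow> nonneg_coeffs (f s t)) \<longrightarrow>
        (\<forall>s t. s \<le> t \<longrightarrow> nonneg_coeffs (F s t))) \<and>
     ((\<forall>s t. s \<le> t \<longrightarrow> nonneg_coeffs (g s t)) \<longrightarrow>
        (\<forall>s t. s \<le> t \<longrightarrow> nonneg_coeffs (G s t))) \<and>
     ((\<forall>s t. s \<le> t \<longrightarrow> nonneg_coeffs (Z s t) \<and> unimodal (Z s t)) \<and>
      (\<forall>s t. s \<le> t \<longrightarrow> nonneg_coeffs (g s t)) \<longrightarrow>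
        (\<forall>s t. s \<le> t \<longrightarrow> unimodal (F s t))) \<and>
     ((\<forall>s t. s \<le> t \<longrightarrow> nonneg_coeffs (Z s t) \<and> unimodal (Z s t)) \<and>
      (\<forall>s t. s \<le> t \<longrightarrow> nonneg_coeffs (f s t)) \<longrightarrow>
        (\<forall>s t. s \<le> t \<longrightarrow> unimodal (G s t)))"
proof -
  interpret KLS \<rho> \<kappa> f g by (rule KLS.intro) (fact assms)+
  show ?thesis
    unfolding assms(6-8) using nonneg_F nonneg_G unimodal_F unimodal_G by blast
qed

end
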